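(* Assume the standing assumptions stated in the context. Let $\{X_k\}_{k\ge 0}$ be generated by the fixed-point iteration described in the context, started from $X_0=0$ (with each frozen continuous-time algebraic Riccati equation solved exactly for its stabilizing solution). Then the following statements hold. (i) $0=X_0\preceq X_1\preceq\cdots\preceq X_k\preceq X_*$, $\mathscr{R}(X_k)\succeq 0$, and $\operatorname{eig}(A_k-G_kX_* )\subset\mathbb{C}_-$ for all $k\ge 0$, where $A_k=A_{c}(X_k)$ and $G_k=G_{c}(X_k)$; (ii) $0\preceq\lim_{k\rightarrow \infty}X_k=X_{*}$ and $\operatorname{eig}\left(A_{c}(X_{*})-G_{c}(X_{*})X_{*}\right)\subset \mathbb{C}_-\cup \iota\mathbb{R}$.
   Context: Let $A\in\mathbb{R}^{n\times n}$, $B\in\mathbb{R}^{n\times m}$, $Q=Q^{T}\in\mathbb{R}^{n\times n}$, $L\in\mathbb{R}^{n\times m}$, $R=R^{T}\in\mathbb{R}^{m\times m}$, and $A_0^i\in\mathbb{R}^{n\times n}$, $B_0^i\in\mathbb{R}^{n\times m}$ for $i=1,\dots,r$; write $A_0^0=A$, $B_0^0=B$. For symmetric $X$ define $\Pi_{11}(X)=\sum_{i=1}^r (A_0^i)^{T}XA_0^i$, $\Pi_{12}(X)=\sum_{i=1}^r (A_0^i)^{T}XB_0^i$, $\Pi_{22}(X)=\sum_{i=1}^r (B_0^i)^{T}XB_0^i$, and $L_c(X)=L+\Pi_{12}(X)$, $R_c(X)=R+\Pi_{22}(X)$, $Q_c(X)=Q+\Pi_{11}(X)$, $A_c(X)=A-BR_c(X)^{-1}L_c(X)^{T}$,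 $G_c(X)=BR_c(X)^{-1}B^{T}$, $H_c(X)=Q_c(X)-L_c(X)R_c(X)^{-1}L_c(X)^{T}$. The stochastic continuous-time algebraic Riccati equation is $\mathscr{R}(X):=A_c(X)^{T}X+XA_c(X)-XG_c(X)X+H_c(X)=0$ (equivalently $A^{T}X+XA+Q+\Pi_{11}(X)-[XB+L+\Pi_{12}(X)][R+\Pi_{22}(X)]^{-1}[XB+L+\Pi_{12}(X)]^{T}=0$). $\mathbb{C}_-$ is the open left half complex plane, $\iota$ the imaginary unit, $\preceq$ the Loewner order. Standing assumptions: $R\succ 0$ and $\begin{bmatrix}Q&L\\L^{T}&R\end{bmatrix}\succeq 0$; $\mathcal{N}(Q-LR^{-1}L^{T})\subseteq \mathcal{N}(L)\cap\bigcap_{i=1}^r\mathcal{N}(A_0^i)$; $(A,B)$ is stabilizable and $(Q-LR^{-1}L^{T},A)$ is detectable; the pair $(\{A_0^i\}_{i=0}^r,\{B_0^i\}_{i=0}^r)$ is (mean-square) stabilizable, i.e. there is $F$ such that $\dot S=(A+BF)S+S(A+BF)^{T}+\sum_{i=1}^r(A_0^i+B_0^iF)S(A_0^i+B_0^iF)^{T}$ is exponentially stable; and with $C^{T}C=Q-LR^{-1}L^{T}$ and $\widetilde A_0^i=A_0^i-B_0^iR^{-1}L^{T}$, the pair $(C,\{\widetilde A_0^i\}_{i=0}^r)$ is detectable, i.e. there is $K$ such that $\dot S=(\widetilde A_0^0+KC)S+S(\widetilde A_0^0+KC)^{T}+\sum_{i=1}^r\widetilde A_0^iS(\widetilde A_0^i)^{T}$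 is exponentially stable. Under these assumptions the equation $\mathscr{R}(X)=0$ has a unique positive semidefinite solution $X_*$, which is also stabilizing. Iteration: given $X_k\succeq 0$, set $A_k=A_c(X_k)$, $G_k=G_c(X_k)$, $H_k=H_c(X_k)$ and let $X_{k+1}$ be the stabilizing solution of the (frozen-coefficient) continuous-time algebraic Riccati equation $A_k^{T}X+XA_k-XG_kX+H_k=0$ (computed in practice by the structure-preserving doubling algorithm).
   Formalization: The null-space assumption is read with N(L^T) in place of N(L), since L is n×m and N(L) would lie in R^m while the other null spaces lie in R^n. *)

theory Defs
  imports "HOL-Analysis.Analysis"
begin

definition sym_mat :: "real^'n^'n \<Rightarrow> bool" where
  "sym_mat M \<longleftrightarrow> transpose M = M"

definition psd :: "real^'n^'n \<Rightarrow> bool" where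
  "psd M \<longleftrightarrow> sym_mat M \<and> (\<forall>x. 0 \<le> x \<bullet> (M *v x))"

definition pd :: "real^'n^'n \<Rightarrow> bool" where
  "pd M \<longleftrightarrow> sym_mat M \<and> (\<forall>x. x \<noteq> 0 \<longrightarrow> 0 < x \<bullet> (M *v x))"

definition loewner_le :: "real^'n^'n \<Rightarrow> real^'n^'n \<Rightarrow> bool" where
  "loewner_le X Y \<longleftrightarrow> psd (Y - X)"

definition cmat :: "real^'n^'n \<Rightarrow> complex^'n^'n" where
  "cmat M = (\<chi> i j. complex_of_real (M $ i $ j))"

definition eigvals :: "real^'n^'n \<Rightarrow> complex set" where
  "eigvals M = {mu. \<exists>v::complex^'n. v \<noteq> 0 \<and> cmat M *v v = mu *s v}"

definition hurwitz :: "real^'n^'n \<Rightarrow> bool" where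
  "hurwitz M \<longleftrightarrow> (\<forall>mu\<in>eigvals M. Re mu < 0)"

definition exp_stable :: "(real^'n^'n \<Rightarrow> real^'n^'n) \<Rightarrow> bool" where
  "exp_stable Lop \<longleftrightarrow> (\<exists>c \<alpha>. \<alpha> > 0 \<and>
     (\<forall>S::real \<Rightarrow> real^'n^'n.
        sym_mat (S 0) \<and> (\<forall>t\<ge>0. (S has_vector_derivative Lop (S t)) (at t within {0..}))
        \<longrightarrow> (\<forall>t\<ge>0. norm (S t) \<le> c * exp (- \<alpha> * t) * norm (S 0))))"

definition Pi11 :: "nat \<Rightarrow> (nat \<Rightarrow> real^'n^'n) \<Rightarrow> real^'n^'n \<Rightarrow> real^'n^'n" where
  "Pi11 r A0 X = (\<Sum>i\<in>{1..r}. transpose (A0 i) ** X ** A0 i)"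

definition Pi12 :: "nat \<Rightarrow> (nat \<Rightarrow> real^'n^'n) \<Rightarrow> (nat \<Rightarrow> real^'m^'n) \<Rightarrow> real^'n^'n \<Rightarrow> real^'m^'n" where
  "Pi12 r A0 B0 X = (\<Sum>i\<in>{1..r}. transpose (A0 i) ** X ** B0 i)"

definition Pi22 :: "nat \<Rightarrow> (nat \<Rightarrow> real^'m^'n) \<Rightarrow> real^'n^'n \<Rightarrow> real^'m^'m" where
  "Pi22 r B0 X = (\<Sum>i\<in>{1..r}. transpose (B0 i) ** X ** B0 i)"

definition Lc where "Lc L r A0 B0 X = L + Pi12 r A0 B0 X"
definition Rc where "Rc R r B0 X = R + Pi22 r B0 X"
definition Qc where "Qc Q r A0 X = Q + Pi11 r A0 X"

definition Ac :: "real^'n^'n \<Rightarrow> real^'m^'n \<Rightarrow> real^'m^'n \<Rightarrow> real^'m^'m \<Rightarrow> nat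
    \<Rightarrow> (nat \<Rightarrow> real^'n^'n) \<Rightarrow> (nat \<Rightarrow> real^'m^'n) \<Rightarrow> real^'n^'n \<Rightarrow> real^'n^'n" where
  "Ac A B L R r A0 B0 X = A - B ** matrix_inv (Rc R r B0 X) ** transpose (Lc L r A0 B0 X)"

definition Gc :: "real^'m^'n \<Rightarrow> real^'m^'m \<Rightarrow> nat \<Rightarrow> (nat \<Rightarrow> real^'m^'n) \<Rightarrow> real^'n^'n \<Rightarrow> real^'n^'n" where
  "Gc B R r B0 X = B ** matrix_inv (Rc R r B0 X) ** transpose B"

definition Hc :: "real^'n^'n \<Rightarrow> real^'m^'n \<Rightarrow> real^'m^'m \<Rightarrow> nat
    \<Rightarrow> (nat \<Rightarrow> real^'n^'n) \<Rightarrow> (nat \<Rightarrow> real^'m^'n) \<Rightarrow> real^'n^'n \<Rightarrow> real^'n^'n" where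
  "Hc Q L R r A0 B0 X = Qc Q r A0 X
     - Lc L r A0 B0 X ** matrix_inv (Rc R r B0 X) ** transpose (Lc L r A0 B0 X)"

definition sriccati :: "real^'n^'n \<Rightarrow> real^'m^'n \<Rightarrow> real^'n^'n \<Rightarrow> real^'m^'n \<Rightarrow> real^'m^'m \<Rightarrow> nat
    \<Rightarrow> (nat \<Rightarrow> real^'n^'n) \<Rightarrow> (nat \<Rightarrow> real^'m^'n) \<Rightarrow> real^'n^'n \<Rightarrow> real^'n^'n" where
  "sriccati A B Q L R r A0 B0 X =
     transpose (Ac A B L R r A0 B0 X) ** X + X ** Ac A B L R r A0 B0 X
     - X ** Gc B R r B0 X ** X + Hc Q L R r A0 B0 X"

definition care_stabilizing_sol :: "real^'n^'n \<Rightarrow> real^'n^'n \<Rightarrow> real^'n^'n \<Rightarrow> real^'n^'n \<Rightarrow> bool" where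
  "care_stabilizing_sol Ak Gk Hk X \<longleftrightarrow> sym_mat X \<and>
     transpose Ak ** X + X ** Ak - X ** Gk ** X + Hk = 0 \<and> hurwitz (Ak - Gk ** X)"

definition standing_assumptions :: "real^'n^'n \<Rightarrow> real^'m^'n \<Rightarrow> real^'n^'n \<Rightarrow> real^'m^'n \<Rightarrow> real^'m^'m \<Rightarrow> nat
    \<Rightarrow> (nat \<Rightarrow> real^'n^'n) \<Rightarrow> (nat \<Rightarrow> real^'m^'n) \<Rightarrow> bool" where
  "standing_assumptions A B Q L R r A0 B0 \<longleftrightarrow>
     (let Ri = matrix_inv R; H0 = Q - L ** Ri ** transpose L in
     sym_mat Q \<and> pd R \<and>
     (\<forall>x y. 0 \<le> x \<bullet> (Q *v x) + x \<bullet> (L *v y) + y \<bullet> (transpose L *v x) + y \<bullet> (R *v y)) \<and>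
     (\<forall>x. H0 *v x = 0 \<longrightarrow> transpose L *v x = 0 \<and> (\<forall>i\<in>{1..r}. A0 i *v x = 0)) \<and>
     (\<exists>F::real^'n^'m. hurwitz (A + B ** F)) \<and>
     (\<exists>K::real^'n^'n. hurwitz (A + K ** H0)) \<and>
     (\<exists>F::real^'n^'m. exp_stable (\<lambda>S. (A + B ** F) ** S + S ** transpose (A + B ** F)
         + (\<Sum>i\<in>{1..r}. (A0 i + B0 i ** F) ** S ** transpose (A0 i + B0 i ** F)))) \<and>
     (\<exists>C::real^'n^'n. transpose C ** C = H0 \<and>
        (\<exists>K::real^'n^'n. exp_stable (\<lambda>S.
            (A - B ** Ri ** transpose L + K ** C) ** S + S ** transpose (A - B ** Ri ** transpose L + K ** C)
          + (\<Sum>i\<in>{1..r}. (A0 i - B0 i ** Ri ** transpose L) ** S ** transpose (A0 i - B0 i ** Ri ** transpose L))))))"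

end

theory Submission
  imports Defs "HOL-Computational_Algebra.Fundamental_Theorem_Algebra"
begin

text \<open>
  With the coefficients frozen at \<open>Y\<close>, the Riccati form \<open>x \<bullet> care Y X x\<close> is the minimum over inputs \<open>u\<close> of
  a Hamiltonian that is monotone in \<open>Y\<close>. Comparing the Hamiltonians of two iterates, or of an
  iterate and \<open>X\<^sub>*\<close>, at the optimal feedback of one of them gives a Lyapunov inequality for a
  Hurwitz closed loop, hence an inequality in the Loewner order; this yields monotonicity and the
  bound by \<open>X\<^sub>*\<close>. The closed loops belonging to \<open>X\<^sub>*\<close> are Hurwitz because an unstable mode would have
  zero cost, hence be undetectable. The limit \<open>Z\<close> of the iterates is again a positive semidefinite
  solution. By the kernel condition the multiplicative noise is dominated by the running cost along
  the closed loop of \<open>Z\<close>, which makes \<open>X\<^sub>* - Z \<le> s Z\<close> improve to \<open>X\<^sub>* - Z \<le> q s Z\<close> for a fixed \<open>q < 1\<close>, so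
  \<open>X\<^sub>* = Z\<close>.
\<close>

section \<open>Hurwitz matrices and the Lyapunov inequality\<close>

text \<open>This is \<open>p(T) x\<close>, the sum of all \<open>a_i T^i x\<close>, by Horner's
  scheme. Letting \<open>T\<close> act on the argument gives a recursion valid for every map
  \<open>T\<close>.\<close>

definition poly_act :: "('a::field^'n \<Rightarrow> 'a^'n) \<Rightarrow> 'a poly \<Rightarrow> 'a^'n \<Rightarrow> 'a^'n" where
  "poly_act T p = fold_coeffs (\<lambda>a f x. a *s x + f (T x)) p (\<lambda>_. 0)"

lemma poly_act_0 [simp]: "poly_act T 0 x = 0"
  by (simp add: poly_act_def)

lemma poly_act_pCons [simp]: "poly_act T (pCons a p) x = a *s x + poly_act T p (T x)"
proof (cases "a = 0 \<and> p = 0")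
  case True
  then show ?thesis by simp
next
  case False
  then show ?thesis
    by (cases "p = 0") (auto simp: poly_act_def)
qed

lemma poly_act_add: "poly_act T (p + q) x = poly_act T p x + poly_act T q x"
  by (induction p q arbitrary: x rule: poly_induct2) (auto simp: vector_sadd_rdistrib)

lemma poly_act_sum: "poly_act T (sum f I) x = (\<Sum>i\<in>I. poly_act T (f i) x)"
  by (induction I rule: infinite_finite_induct) (auto simp: poly_act_add)

lemma poly_act_smult: "poly_act T (smult c p) x = c *s poly_act T p x"
  by (induction p arbitrary: x) (auto simp: vector_add_ldistrib)

lemma poly_act_monom: "poly_act T (monom c i) x = c *s (T ^^ i) x"
  by (induction i arbitrary: x) (auto simp: monom_0 monom_Suc funpow_swap1)

lemma poly_act_diff_smult:
  "poly_act ((*v) C) p (x - c *s y) = poly_act ((*v) C) p x - c *s poly_act ((*v) C) p y"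
  by (induction p arbitrary: x y)
     (auto simp: matrix_vector_mult_diff_distrib vector_scalar_commute vector_smult_assoc
        vector_ssub_ldistrib vector_add_ldistrib mult.commute)

lemma poly_act_commute: "poly_act ((*v) C) p (C *v x) = C *v poly_act ((*v) C) p x"
  by (induction p arbitrary: x) (auto simp: matrix_vector_right_distrib vector_scalar_commute)

text \<open>\<open>p(C) x\<close> is additive in \<open>p\<close> and linear in \<open>x\<close>, so
  the factor belonging to a root may act first. This splits a root off an annihilating
  polynomial.\<close>

lemma poly_act_linear_factor:
  "poly_act ((*v) C) ([:- c, 1:] * q) x = poly_act ((*v) C) q (C *v x - c *s x)"
proof -
  have "[:- c, 1:] * q = pCons 0 q + smult (- c) q" by simp
  then show ?thesis
    unfolding poly_act_diff_smult by (simp only: poly_act_add poly_act_smult) simp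
qed

lemma smult_complex_of_real: "complex_of_real c *s v = c *\<^sub>R v"
  by (simp add: vec_eq_iff complex_eq_iff)

text \<open>The first \<open>DIM + 1\<close> iterates of \<open>x\<close> either repeat, and a
  difference of two monomials works, or are linearly dependent over the reals, and the coefficients
  of a relation form the polynomial.\<close>

lemma annihilating_poly_exists:
  fixes T :: "complex^'n \<Rightarrow> complex^'n"
  shows "\<exists>p. p \<noteq> 0 \<and> poly_act T p x = 0"
proof (cases "inj_on (\<lambda>i. (T ^^ i) x) {..DIM(complex^'n)}")
  case False
  then obtain i j where ij: "i \<noteq> j" "(T ^^ i) x = (T ^^ j) x"
    by (auto simp: inj_on_def)
  have "coeff (monom 1 i + monom (-1) j :: complex poly) i \<noteq> 0"
    using ij(1) by simp
  then have "(monom 1 i + monom (-1) j :: complex poly) \<noteq> 0" by (metis coeff_0)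
  moreover have "poly_act T (monom 1 i + monom (-1) j) x = 0"
    using ij(2) by (simp add: poly_act_add poly_act_monom)
  ultimately show ?thesis by blast
next
  case True
  let ?S = "(\<lambda>i. (T ^^ i) x) ` {..DIM(complex^'n)}"
  have "dependent ?S"
    by (rule dependent_biggerset) (subst card_image[OF True], simp)
  then obtain u v where v: "v \<in> ?S" "u v \<noteq> 0" "(\<Sum>w\<in>?S. u w *\<^sub>R w) = 0"
    using dependent_finite[of ?S] by auto
  then obtain j where j: "j \<le> DIM(complex^'n)" "v = (T ^^ j) x" by auto
  define c where "c i = complex_of_real (u ((T ^^ i) x))" for i
  define p where "p = (\<Sum>i\<le>DIM(complex^'n). monom (c i) i)"
  have "coeff p j = c j"
    using j(1) by (simp add: p_def coeff_sum if_distrib cong: if_cong)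
  then have "p \<noteq> 0" using v(2) j(2) by (auto simp: c_def)
  moreover have "poly_act T p x = (\<Sum>i\<le>DIM(complex^'n). u ((T ^^ i) x) *\<^sub>R (T ^^ i) x)"
    by (simp add: p_def poly_act_sum poly_act_monom c_def smult_complex_of_real)
  moreover have "\<dots> = 0"
    using v(3) by (subst (asm) sum.reindex[OF True]) simp
  ultimately show ?thesis by metis
qed

lemma tendsto_zero_of_contractive_recurrence:
  fixes f :: "nat \<Rightarrow> real"
  assumes nonneg: "\<And>k. 0 \<le> f k" and rec: "\<And>k. f (Suc k) \<le> q * f k + e k"
    and q: "0 \<le> q" "q < 1" and e: "e \<longlonglongrightarrow> 0"
  shows "f \<longlonglongrightarrow> 0"
proof (rule LIMSEQ_I)
  fix \<epsilon> :: real assume \<epsilon>: "0 < \<epsilon>"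
  \<comment> \<open>\<open>d\<close> makes \<epsilon>/2 the fixed point of
    \<open>t -> q t + d\<close>.\<close>
  define d where "d = (1 - q) * \<epsilon> / 2"
  have "d > 0" using q \<epsilon> by (simp add: d_def)
  then obtain N where N: "\<And>k. k \<ge> N \<Longrightarrow> norm (e k - 0) < d"
    using LIMSEQ_D[OF e] by blast
  have bound: "f (N + k) \<le> q ^ k * f N + \<epsilon> / 2" for k
  proof (induction k)
    case 0
    then show ?case using \<epsilon> by simp
  next
    case (Suc k)
    have "f (N + Suc k) \<le> q * f (N + k) + d"
      using rec[of "N + k"] N[of "N + k"] by auto
    also have "\<dots> \<le> q * (q ^ k * f N + \<epsilon> / 2) + d"
      using Suc q(1) by (simp add: mult_left_mono)
    also have "\<dots> = q ^ Suc k * f N + \<epsilon> / 2"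
      by (simp add: d_def field_simps)
    finally show ?case .
  qed
  have "(\<lambda>k. q ^ k * f N) \<longlonglongrightarrow> 0"
    using LIMSEQ_realpow_zero[OF q] tendsto_mult_left_zero by blast
  then obtain K where K: "\<And>k. k \<ge> K \<Longrightarrow> norm (q ^ k * f N - 0) < \<epsilon> / 2"
    using LIMSEQ_D[of _ 0 "\<epsilon> / 2"] \<epsilon> by fastforce
  have "norm (f n - 0) < \<epsilon>" if "n \<ge> N + K" for n
  proof -
    have "\<bar>q ^ (n - N) * f N\<bar> < \<epsilon> / 2" using K[of "n - N"] that by simp
    then show ?thesis using bound[of "n - N"] nonneg[of n] that by simp
  qed
  then show "\<exists>no. \<forall>n\<ge>no. norm (f n - 0) < \<epsilon>" by blast
qed

lemma norm_smult_complex: "norm (c *s (x::complex^'n)) = norm c * norm x"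
  by (simp add: norm_vec_def norm_mult L2_set_right_distrib)

text \<open>Induction on the degree of a polynomial annihilating \<open>x\<close> replaces the
  Jordan form: a root inside the unit disc turns the orbit into a contractive recurrence driven by a
  vector of lower degree, and any other root can be cancelled.\<close>

lemma matrix_powers_tendsto_zero:
  fixes C :: "complex^'n^'n"
  assumes eig: "\<And>c v. v \<noteq> 0 \<Longrightarrow> C *v v = c *s v \<Longrightarrow> norm c < 1"
  shows "(\<lambda>k. ((*v) C ^^ k) x) \<longlonglongrightarrow> 0"
proof -
  have "poly_act ((*v) C) p x = 0 \<Longrightarrow> p \<noteq> 0 \<Longrightarrow> (\<lambda>k. ((*v) C ^^ k) x) \<longlonglongrightarrow> 0" for p
  proof (induction "degree p" arbitrary: p x)
    case 0
    then obtain a where "p = [:a:]" by (metis degree_eq_zeroE)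
    with 0 have "x = 0" by (auto simp: vec_eq_iff)
    moreover have "((*v) C ^^ k) 0 = 0" for k by (induction k) auto
    ultimately show ?case by simp
  next
    case (Suc d)
    then have "\<not> constant (poly p)" by (simp add: constant_degree)
    then obtain c where "poly p c = 0" using fundamental_theorem_of_algebra by blast
    then obtain q where q: "p = [:- c, 1:] * q" by (metis poly_eq_0_iff_dvd dvdE)
    with Suc.prems have "q \<noteq> 0" by auto
    have "degree p = Suc (degree q)"
      unfolding q by (subst degree_mult_eq) (use \<open>q \<noteq> 0\<close> in auto)
    with Suc.hyps have dq: "d = degree q" by simp
    have q0: "poly_act ((*v) C) q (C *v x - c *s x) = 0"
      using Suc.prems(1) unfolding q poly_act_linear_factor .
    show ?case
    proof (cases "norm c < 1")
      case False
      \<comment> \<open>A nonzero \<open>q(C) x\<close> would be an eigenvector for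
        \<open>c\<close>, so \<open>q\<close> already annihilates \<open>x\<close>.\<close>
      have "C *v poly_act ((*v) C) q x = c *s poly_act ((*v) C) q x"
        using q0 by (simp add: poly_act_diff_smult poly_act_commute)
      then have "poly_act ((*v) C) q x = 0" using eig False by blast
      then show ?thesis using Suc.hyps(1)[OF dq] \<open>q \<noteq> 0\<close> by blast
    next
      case True
      define y where "y = C *v x - c *s x"
      have lim: "(\<lambda>k. ((*v) C ^^ k) y) \<longlonglongrightarrow> 0"
        using Suc.hyps(1)[OF dq q0 \<open>q \<noteq> 0\<close>] by (simp add: y_def)
      have step: "((*v) C ^^ Suc k) x = c *s ((*v) C ^^ k) x + ((*v) C ^^ k) y" for k
      proof (induction k)
        case 0
        then show ?case by (simp add: y_def)
      next
        case (Suc k)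
        have "((*v) C ^^ Suc (Suc k)) x = C *v (c *s ((*v) C ^^ k) x + ((*v) C ^^ k) y)"
          using Suc by simp
        also have "\<dots> = c *s ((*v) C ^^ Suc k) x + ((*v) C ^^ Suc k) y"
          by (simp add: matrix_vector_right_distrib vector_scalar_commute)
        finally show ?case .
      qed
      have "(\<lambda>k. norm (((*v) C ^^ k) x)) \<longlonglongrightarrow> 0"
      proof (rule tendsto_zero_of_contractive_recurrence)
        show "norm (((*v) C ^^ Suc k) x) \<le> norm c * norm (((*v) C ^^ k) x) + norm (((*v) C ^^ k) y)" for k
          unfolding step by (metis norm_smult_complex norm_triangle_ineq)
        show "(\<lambda>k. norm (((*v) C ^^ k) y)) \<longlonglongrightarrow> 0"
          using tendsto_norm_zero[OF lim] .
      qed (use True in auto)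
      then show ?thesis by (rule tendsto_norm_zero_cancel)
    qed
  qed
  then show ?thesis using annihilating_poly_exists by blast
qed

section \<open>Complex eigenvectors as pairs of real vectors\<close>

definition cvec :: "real^'n \<Rightarrow> real^'n \<Rightarrow> complex^'n" where
  "cvec a b = (\<chi> i. Complex (a $ i) (b $ i))"

lemma cmat_mult_cvec: "cmat M *v cvec a b = cvec (M *v a) (M *v b)"
  by (auto simp: vec_eq_iff cmat_def cvec_def matrix_vector_mult_def complex_eq_iff)

lemma cvec_cases: obtains a b where "v = cvec a b"
  by (rule that[of "\<chi> i. Re (v $ i)" "\<chi> i. Im (v $ i)"]) (simp add: cvec_def vec_eq_iff)

lemma cvec_eq_iff: "cvec a b = cvec a' b' \<longleftrightarrow> a = a' \<and> b = b'"
  by (auto simp: cvec_def vec_eq_iff)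

lemma cvec_eq_0_iff: "cvec a b = 0 \<longleftrightarrow> a = 0 \<and> b = 0"
  by (auto simp: cvec_def vec_eq_iff complex_eq_iff)

lemma smult_cvec: "c *s cvec a b = cvec (Re c *\<^sub>R a - Im c *\<^sub>R b) (Im c *\<^sub>R a + Re c *\<^sub>R b)"
  by (auto simp: vec_eq_iff cvec_def complex_eq_iff)

text \<open>The eigenvalue \<open>s + i w\<close> with eigenvector \<open>a + i b\<close> is split
  into real and imaginary parts, which keeps the stability arguments over the reals.\<close>

lemma hurwitz_iff_real:
  "hurwitz M \<longleftrightarrow> (\<forall>s w a b. a \<noteq> 0 \<or> b \<noteq> 0 \<longrightarrow> M *v a = s *\<^sub>R a - w *\<^sub>R b
      \<longrightarrow> M *v b = w *\<^sub>R a + s *\<^sub>R b \<longrightarrow> s < 0)" (is "_ \<longleftrightarrow> ?r")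
proof
  assume h: "hurwitz M"
  show ?r
  proof (intro allI impI)
    fix s w :: real and a b
    assume "a \<noteq> 0 \<or> b \<noteq> 0" "M *v a = s *\<^sub>R a - w *\<^sub>R b" "M *v b = w *\<^sub>R a + s *\<^sub>R b"
    then have "Complex s w \<in> eigvals M"
      unfolding eigvals_def by (auto intro!: exI[of _ "cvec a b"] simp: cvec_eq_0_iff cmat_mult_cvec smult_cvec)
    then show "s < 0" using h by (auto simp: hurwitz_def)
  qed
next
  assume r: ?r
  show "hurwitz M"
    unfolding hurwitz_def eigvals_def
  proof clarsimp
    fix c v assume v: "v \<noteq> 0" "cmat M *v v = c *s v"
    obtain a b where "v = cvec a b" by (rule cvec_cases)
    with v r show "Re c < 0"
      by (auto simp: cvec_eq_0_iff cmat_mult_cvec smult_cvec cvec_eq_iff)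
  qed
qed

text \<open>The Cayley transform \<open>C = (1 - M)\<^sup>-\<^sup>1 (1 + M)\<close> maps the left half plane to the unit disc, so its
  powers vanish in the limit, and \<open>x \<bullet> X x\<close> decreases along its orbits.\<close>
lemma lyapunov_nonneg:
  fixes M X :: "real^'n^'n"
  assumes M: "hurwitz M" and X: "sym_mat X" and le: "\<And>x. (X *v x) \<bullet> (M *v x) \<le> 0"
  shows "0 \<le> x \<bullet> (X *v x)"
proof -
  \<comment> \<open>1 is not an eigenvalue of a Hurwitz matrix, so \<open>1 - M\<close> is
    invertible.\<close>
  have "x = 0" if "(mat 1 - M) *v x = 0" for x
  proof (rule ccontr)
    assume "x \<noteq> 0"
    have "M *v x = x" using that by (simp add: matrix_vector_mult_diff_rdistrib)
    then show False
      using M[unfolded hurwitz_iff_real, rule_format, of x 0 1 0] \<open>x \<noteq> 0\<close> by auto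
  qed
  then obtain N where N: "N ** (mat 1 - M) = mat 1"
    using matrix_left_invertible_ker[of "mat 1 - M"] by blast
  define C where "C = N ** (mat 1 + M)"
  have CM: "(mat 1 - M) ** C = mat 1 + M"
    unfolding C_def matrix_mul_assoc using N matrix_left_right_inverse by (metis matrix_mul_lid)
  have C1: "C *v y - M *v (C *v y) = y + M *v y" for y
    using arg_cong[OF CM, of "\<lambda>Z. Z *v y"]
    by (simp add: matrix_vector_mul_assoc[symmetric] matrix_vector_mult_diff_rdistrib matrix_vector_mult_add_rdistrib)
  \<comment> \<open>An eigenvalue \<open>c\<close> of \<open>C\<close> comes from the eigenvalue
    \<open>(c - 1) / (1 + c)\<close> of \<open>M\<close>, whose real part has the sign of
    \<open>|c|^2 - 1\<close>.\<close>
  have eigC: "norm c < 1" if "v \<noteq> 0" "cmat C *v v = c *s v" for c v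
  proof -
    obtain a b where v: "v = cvec a b" by (rule cvec_cases)
    have "cmat C *v v - cmat M *v (cmat C *v v) = v + cmat M *v v"
      unfolding v cmat_mult_cvec using C1[of a] C1[of b]
      by (simp add: cvec_def vec_eq_iff complex_eq_iff)
    then have e: "(1 + c) *s (cmat M *v v) = (c - 1) *s v"
      unfolding that(2) vector_scalar_commute
      by (simp add: vec_eq_iff algebra_simps)
    have "c \<noteq> -1"
    proof
      assume "c = -1"
      with e have "v = 0" by (auto simp: vec_eq_iff)
      with that show False by simp
    qed
    then have c: "1 + c \<noteq> 0" by (metis add.inverse_inverse add_eq_0_iff)
    have "cmat M *v v = ((c - 1) / (1 + c)) *s v"
      using e c by (simp add: vec_eq_iff field_simps)
    then have "Re ((c - 1) / (1 + c)) < 0"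
      using M that(1) by (auto simp: hurwitz_def eigvals_def)
    moreover have "Re ((c - 1) / (1 + c)) = ((Re c)\<^sup>2 + (Im c)\<^sup>2 - 1) / ((1 + Re c)\<^sup>2 + (Im c)\<^sup>2)"
      by (simp add: Re_divide power2_eq_square algebra_simps)
    ultimately have "(Re c)\<^sup>2 + (Im c)\<^sup>2 < 1"
      using sum_power2_ge_zero[of "1 + Re c" "Im c"] by (simp add: divide_less_0_iff not_less[symmetric])
    then show ?thesis by (simp add: norm_complex_def)
  qed
  define y where "y k = ((*v) C ^^ k) x" for k
  have "((*v) (cmat C) ^^ k) (cvec x 0) = cvec (y k) 0" for k
    by (induction k) (auto simp: y_def cmat_mult_cvec)
  then have "(\<lambda>k. cvec (y k) 0) \<longlonglongrightarrow> 0"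
    using matrix_powers_tendsto_zero[of "cmat C" "cvec x 0", OF eigC] by simp
  then have "(\<lambda>k. Re (cvec (y k) 0 $ i)) \<longlonglongrightarrow> Re (0 $ i)" for i
    by (intro tendsto_Re tendsto_vec_nth)
  then have ylim: "y \<longlonglongrightarrow> 0"
    by (intro vec_tendstoI) (simp add: cvec_def)
  have Xsym: "(X *v u) \<bullet> z = u \<bullet> (X *v z)" for u z
    using X by (metis dot_lmul_matrix sym_mat_def transpose_matrix_vector)
  have dec: "y (Suc k) \<bullet> (X *v y (Suc k)) \<le> y k \<bullet> (X *v y k)" for k
  proof -
    \<comment> \<open>\<open>M\<close> maps the sum of two consecutive orbit points to their
      difference, so the hypothesis at the sum is exactly the decrease of the quadratic
      form.\<close>
    let ?u = "y (Suc k) + y k"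
    have "M *v ?u = y (Suc k) - y k"
      using C1[of "y k"] by (simp add: y_def matrix_vector_right_distrib algebra_simps)
    then have "(X *v ?u) \<bullet> (y (Suc k) - y k) \<le> 0" using le[of ?u] by simp
    then show ?thesis
      using Xsym[of "y k" "y (Suc k)"]
      by (simp add: matrix_vector_right_distrib algebra_simps inner_simps inner_commute)
  qed
  have "(\<lambda>k. y k \<bullet> (X *v y k)) \<longlonglongrightarrow> 0 \<bullet> (X *v 0)"
    by (intro tendsto_inner ylim bounded_linear.tendsto[OF matrix_vector_mul_bounded_linear])
  moreover have "y k \<bullet> (X *v y k) \<le> y 0 \<bullet> (X *v y 0)" for k
    by (induction k) (use dec order_trans in auto)
  ultimately have "0 \<bullet> (X *v 0) \<le> y 0 \<bullet> (X *v y 0)"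
    using LIMSEQ_le_const2 by blast
  then show ?thesis by (simp add: y_def)
qed

section \<open>Symmetric and semidefinite matrices\<close>

lemma inner_vector_matrix: "y \<bullet> (x v* A) = x \<bullet> (A *v y)" for A :: "real^'m^'n"
  by (metis dot_lmul_matrix inner_commute)

lemma sym_mat_inner: "sym_mat X \<Longrightarrow> (X *v u) \<bullet> z = u \<bullet> (X *v z)"
  by (metis dot_lmul_matrix sym_mat_def transpose_matrix_vector)

lemma sym_mat_vector_matrix: "sym_mat X \<Longrightarrow> x v* X = X *v x"
  by (metis sym_mat_def transpose_matrix_vector)

lemma sym_matI:
  assumes "\<And>u z. u \<bullet> (X *v z) = z \<bullet> (X *v u)"
  shows "sym_mat X"
proof -
  have "transpose X *v u = X *v u" for u
    by (metis assms dot_lmul_matrix inner_commute transpose_matrix_vector vector_eq_rdot)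
  then show ?thesis unfolding sym_mat_def matrix_eq by blast
qed

lemma sym_mat_swap: "sym_mat X \<Longrightarrow> u \<bullet> (X *v z) = z \<bullet> (X *v u)"
  by (metis inner_commute sym_mat_inner)

lemma sym_mat_diff: "sym_mat Y \<Longrightarrow> sym_mat Z \<Longrightarrow> sym_mat (Y - Z)"
  by (simp add: sym_mat_def transpose_def vec_eq_iff)

lemma sym_mat_scaleR: "sym_mat Y \<Longrightarrow> sym_mat (c *\<^sub>R Y)"
  by (simp add: sym_mat_def transpose_def vec_eq_iff)

lemma psd_0: "psd (0 :: real^'k^'k)"
  by (simp add: psd_def sym_mat_def transpose_def vec_eq_iff)

lemma sum_matrix_vector_mult: "sum M I *v x = (\<Sum>i\<in>I. M i *v x)" for M :: "'i \<Rightarrow> real^'m^'n"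
  by (induction I rule: infinite_finite_induct) (auto simp: matrix_vector_mult_add_rdistrib)

lemma vector_matrix_mult_sum: "x v* sum M I = (\<Sum>i\<in>I. x v* M i)" for M :: "'i \<Rightarrow> real^'m^'n"
  by (induction I rule: infinite_finite_induct) (auto simp: vector_matrix_mult_add_rdistrib)

lemma uminus_matrix_vector: "(- M) *v x = - (M *v x)" for M :: "real^'m^'n"
  using matrix_vector_mult_diff_rdistrib[of 0 M x] by simp

lemma pd_matrix_inv:
  assumes "pd S"
  shows "S ** matrix_inv S = mat 1"
proof -
  have "x = 0" if "S *v x = 0" for x
    using assms that unfolding pd_def by (metis inner_zero_right less_irrefl)
  then obtain N where "N ** S = mat 1"
    using matrix_left_invertible_ker[of S] by blast
  then have "\<exists>N. S ** N = mat 1 \<and> N ** S = mat 1"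
    using matrix_left_right_inverse by blast
  then show ?thesis unfolding matrix_inv_def by (metis (mono_tags, lifting) someI_ex)
qed

text \<open>Move from \<open>x\<close> against \<open>W x\<close>: if \<open>W x\<close> were
  nonzero, the linear term would make the form negative for a small step.\<close>

lemma psd_ker:
  assumes "psd W" "x \<bullet> (W *v x) = 0"
  shows "W *v x = 0"
proof -
  have sym: "sym_mat W" and nonneg: "\<And>y. 0 \<le> y \<bullet> (W *v y)"
    using assms by (auto simp: psd_def)
  let ?y = "W *v x"
  have *: "0 \<le> - 2 * t * (?y \<bullet> ?y) + t\<^sup>2 * (?y \<bullet> (W *v ?y))" for t :: real
    using nonneg[of "x - t *\<^sub>R ?y"] assms(2) sym_mat_inner[OF sym, of x ?y]
    by (simp add: matrix_vector_mult_diff_distrib matrix_vector_mult_scaleR inner_simps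
        power2_eq_square algebra_simps inner_commute)
  define p where "p = ?y \<bullet> (W *v ?y)"
  have p: "p \<ge> 0" using nonneg by (simp add: p_def)
  show ?thesis
  proof (rule ccontr)
    assume "?y \<noteq> 0"
    then have y: "?y \<bullet> ?y > 0" by simp
    \<comment> \<open>The step is small enough for the linear term to win; the \<open>+ 1\<close>
      covers \<open>p = 0\<close>.\<close>
    define s where "s = (?y \<bullet> ?y) / (p + 1)"
    have s: "s > 0" "s * p \<le> ?y \<bullet> ?y"
      using y p by (auto simp: s_def field_simps)
    have "s * (2 * (?y \<bullet> ?y)) \<le> s * (s * p)" using *[of s] by (simp add: p_def power2_eq_square)
    then have "2 * (?y \<bullet> ?y) \<le> s * p" using s(1) by simp
    with s y show False by linarith
  qed
qed

text \<open>Both forms ignore the component in the kernel of \<open>W\<close>. On the unit sphere of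
  its orthogonal complement \<open>W\<close> is positive, and compactness bounds the
  quotient.\<close>

lemma psd_domination:
  fixes W V :: "real^'n^'n"
  assumes W: "psd W" and V: "sym_mat V" and ker: "\<And>x. W *v x = 0 \<Longrightarrow> V *v x = 0"
  shows "\<exists>c\<ge>0. \<forall>x. x \<bullet> (V *v x) \<le> c * (x \<bullet> (W *v x))"
proof -
  have symW: "sym_mat W" and nonneg: "\<And>y. 0 \<le> y \<bullet> (W *v y)"
    using W by (auto simp: psd_def)
  define K where "K = {x. W *v x = 0}"
  have K: "subspace K"
    by (auto simp: K_def subspace_def matrix_vector_right_distrib matrix_vector_mult_scaleR)
  define Z where "Z = sphere 0 1 \<inter> (\<Inter>y\<in>K. {z. z \<bullet> y = 0})"
  have "closed {z. z \<bullet> y = 0}" for y :: "real^'n"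
    by (intro closed_Collect_eq continuous_intros)
  then have "compact Z" unfolding Z_def
    by (intro compact_Int_closed compact_sphere closed_INT) auto
  define f where "f z = (z \<bullet> (V *v z)) / (z \<bullet> (W *v z))" for z
  have pos: "0 < z \<bullet> (W *v z)" if "z \<in> Z" for z
  proof -
    have "z \<bullet> (W *v z) \<noteq> 0"
    proof
      assume "z \<bullet> (W *v z) = 0"
      then have "z \<in> K" using psd_ker[OF W] by (simp add: K_def)
      with that have "z \<bullet> z = 0" by (auto simp: Z_def)
      with that show False by (simp add: Z_def)
    qed
    with nonneg[of z] show ?thesis by linarith
  qed
  have contf: "continuous_on Z f"
    unfolding f_def
    by (intro continuous_intros linear_continuous_on matrix_vector_mul_bounded_linear)
       (use pos in fastforce)
  have "bdd_above (f ` Z)"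
    using compact_continuous_image[OF contf \<open>compact Z\<close>]
    by (simp add: bounded_imp_bdd_above compact_imp_bounded)
  then obtain b where b: "\<And>z. z \<in> Z \<Longrightarrow> f z \<le> b"
    by (auto simp: bdd_above_def)
  \<comment> \<open>The bound \<open>b\<close> may be negative, and is arbitrary when
    \<open>Z\<close> is empty.\<close>
  define c where "c = max 0 b"
  have c: "c \<ge> 0" "\<And>z. z \<in> Z \<Longrightarrow> f z \<le> c"
    using b by (auto simp: c_def le_max_iff_disj)
  have "x \<bullet> (V *v x) \<le> c * (x \<bullet> (W *v x))" for x
  proof -
    obtain y z where yz: "y \<in> K" "\<And>w. w \<in> K \<Longrightarrow> orthogonal z w" "x = y + z"
      using orthogonal_subspace_decomp_exists[of K x] span_eq_iff[of K] K by metis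
    have Wy: "W *v y = 0" and Vy: "V *v y = 0" using yz ker by (auto simp: K_def)
    have red: "x \<bullet> (W *v x) = z \<bullet> (W *v z)" "x \<bullet> (V *v x) = z \<bullet> (V *v z)"
      using sym_mat_inner[OF symW, of y z] sym_mat_inner[OF V, of y z] Wy Vy
      by (auto simp: yz(3) matrix_vector_right_distrib inner_simps)
    have "z \<bullet> (V *v z) \<le> c * (z \<bullet> (W *v z))"
    proof (cases "z = 0")
      case False
      define e where "e = z /\<^sub>R norm z"
      have "e \<in> Z" using False yz(2) by (auto simp: Z_def e_def orthogonal_def)
      then have le: "e \<bullet> (V *v e) \<le> c * (e \<bullet> (W *v e))"
        using c(2)[of e] pos[of e] by (simp add: f_def divide_le_eq)
      have sc: "z \<bullet> (M *v z) = (norm z)\<^sup>2 * (e \<bullet> (M *v e))" for M :: "real^'n^'n"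
        using False by (simp add: e_def matrix_vector_mult_scaleR power2_eq_square field_simps)
      show ?thesis
        unfolding sc mult.left_commute[of c] by (rule mult_left_mono[OF le]) simp
    qed simp
    then show ?thesis by (simp add: red)
  qed
  with c(1) show ?thesis by blast
qed

section \<open>Limits of matrix sequences\<close>

lemma tendsto_matrix_vector_mult:
  fixes M :: "'a \<Rightarrow> real^'m^'n"
  shows "(M \<longlongrightarrow> N) F \<Longrightarrow> ((\<lambda>k. M k *v x) \<longlongrightarrow> N *v x) F"
  unfolding matrix_vector_mult_def
  by (intro vec_tendstoI) (auto intro!: tendsto_intros)

lemma tendsto_vector_matrix_mult:
  fixes M :: "real^'m^'n"
  shows "(v \<longlongrightarrow> w) F \<Longrightarrow> ((\<lambda>k. v k v* M) \<longlongrightarrow> w v* M) F"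
  unfolding transpose_matrix_vector[symmetric]
  by (rule bounded_linear.tendsto[OF matrix_vector_mul_bounded_linear])

text \<open>Each quadratic form is a bounded increasing sequence; polarization carries convergence
  to the bilinear forms, and thus to the entries.\<close>

lemma monotone_symmetric_convergent:
  fixes X :: "nat \<Rightarrow> real^'n^'n"
  assumes sym: "\<And>k. sym_mat (X k)"
    and mono: "\<And>k x. x \<bullet> (X k *v x) \<le> x \<bullet> (X (Suc k) *v x)"
    and bound: "\<And>k x. x \<bullet> (X k *v x) \<le> x \<bullet> (Y *v x)"
  shows "\<exists>Z. X \<longlonglongrightarrow> Z"
proof -
  have quad: "convergent (\<lambda>k. x \<bullet> (X k *v x))" for x
  proof -
    have "incseq (\<lambda>k. x \<bullet> (X k *v x))" by (rule incseq_SucI) (rule mono)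
    then obtain l where "(\<lambda>k. x \<bullet> (X k *v x)) \<longlonglongrightarrow> l"
      by (rule incseq_convergent[where B = "x \<bullet> (Y *v x)"]) (use bound in auto)
    then show ?thesis by (rule convergentI)
  qed
  have bil: "convergent (\<lambda>k. u \<bullet> (X k *v v))" for u v
  proof -
    have eq: "u \<bullet> (X k *v v) =
      (1/2) * ((u + v) \<bullet> (X k *v (u + v)) - u \<bullet> (X k *v u) - v \<bullet> (X k *v v))" for k
    proof -
      have "v \<bullet> (X k *v u) = u \<bullet> (X k *v v)"
        using sym_mat_inner[OF sym[of k], of v u] by (metis inner_commute)
      then show ?thesis by (simp add: matrix_vector_right_distrib inner_add_left inner_add_right)
    qed
    show ?thesis unfolding eq
      by (intro convergent_mult convergent_const convergent_diff quad)
  qed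
  have "X k $ i $ j = axis i 1 \<bullet> (X k *v axis j 1)" for k i j
    by (simp add: inner_axis' matrix_vector_mult_basis column_def)
  then have "\<exists>z. (\<lambda>k. X k $ i $ j) \<longlonglongrightarrow> z" for i j
    using bil[of "axis i 1" "axis j 1"] by (simp add: convergent_def)
  then obtain z where "\<And>i j. (\<lambda>k. X k $ i $ j) \<longlonglongrightarrow> z i j" by metis
  then have "X \<longlonglongrightarrow> (\<chi> i j. z i j)"
    by (intro vec_tendstoI) simp
  then show ?thesis by blast
qed

section \<open>The Hamiltonian of the frozen Riccati equation\<close>

locale riccati_system =
  fixes A :: "real^'n^'n" and B :: "real^'m^'n" and Q :: "real^'n^'n"
    and L :: "real^'m^'n" and R :: "real^'m^'m" and r :: nat
    and A0 :: "nat \<Rightarrow> real^'n^'n" and B0 :: "nat \<Rightarrow> real^'m^'n"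
  assumes Q_sym: "sym_mat Q" and R_pd: "pd R"
    and weight_nonneg: "\<And>x y. 0 \<le> x \<bullet> (Q *v x) + x \<bullet> (L *v y) + y \<bullet> (transpose L *v x) + y \<bullet> (R *v y)"
    and kernel: "\<And>x. (Q - L ** matrix_inv R ** transpose L) *v x = 0
      \<Longrightarrow> transpose L *v x = 0 \<and> (\<forall>i\<in>{1..r}. A0 i *v x = 0)"
    and detectable: "\<exists>K. hurwitz (A + K ** (Q - L ** matrix_inv R ** transpose L))"
begin

text \<open>The quadratic form of the block weight with rows \<open>Q, L\<close> and
  \<open>L^T, R\<close> at the pair \<open>(x, u)\<close>.\<close>

definition cost :: "real^'n \<Rightarrow> real^'m \<Rightarrow> real" where
  "cost x u = x \<bullet> (Q *v x) + 2 * (x \<bullet> (L *v u)) + u \<bullet> (R *v u)"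

definition noise :: "real^'n^'n \<Rightarrow> real^'n \<Rightarrow> real^'m \<Rightarrow> real" where
  "noise Y x u = (\<Sum>i\<in>{1..r}. (A0 i *v x + B0 i *v u) \<bullet> (Y *v (A0 i *v x + B0 i *v u)))"

text \<open>The Hamiltonian of the Riccati equation whose coefficients are frozen at \<open>Y\<close>; minimising it over
  the input \<open>u\<close> gives the quadratic form of \<open>care Y X\<close>, and the minimiser is \<open>u = gain Y X x\<close>.\<close>
definition ham :: "real^'n^'n \<Rightarrow> real^'n^'n \<Rightarrow> real^'n \<Rightarrow> real^'m \<Rightarrow> real" where
  "ham Y X x u = 2 * ((X *v x) \<bullet> (A *v x + B *v u)) + cost x u + noise Y x u"

definition care :: "real^'n^'n \<Rightarrow> real^'n^'n \<Rightarrow> real^'n^'n" where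
  "care Y X = transpose (Ac A B L R r A0 B0 Y) ** X + X ** Ac A B L R r A0 B0 Y
     - X ** Gc B R r B0 Y ** X + Hc Q L R r A0 B0 Y"

definition gain :: "real^'n^'n \<Rightarrow> real^'n^'n \<Rightarrow> real^'n^'m" where
  "gain Y X = - (matrix_inv (Rc R r B0 Y) ** (transpose B ** X + transpose (Lc L r A0 B0 Y)))"

text \<open>Half the gradient of \<open>ham Y X x\<close> in \<open>u\<close> for symmetric
  \<open>Y\<close>. It contains no inverse, so its continuity in \<open>Y\<close> and
  \<open>X\<close> is immediate.\<close>

definition grad :: "real^'n^'n \<Rightarrow> real^'n^'n \<Rightarrow> real^'n \<Rightarrow> real^'m \<Rightarrow> real^'m" where
  "grad Y X x u = R *v u + (X *v x) v* B + x v* L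
     + (\<Sum>i\<in>{1..r}. (Y *v (A0 i *v x + B0 i *v u)) v* B0 i)"

lemmas matrix_expand = matrix_vector_mul_assoc[symmetric] matrix_vector_mult_add_rdistrib
  matrix_vector_mult_diff_rdistrib matrix_vector_right_distrib uminus_matrix_vector

lemma noise_nonneg: "psd Y \<Longrightarrow> 0 \<le> noise Y x u"
  unfolding noise_def by (intro sum_nonneg) (simp add: psd_def)

lemma noise_diff: "noise (Y - Z) x u = noise Y x u - noise Z x u"
  by (simp add: noise_def sum_subtractf[symmetric] matrix_vector_mult_diff_rdistrib inner_diff_right)

lemma cost_nonneg: "0 \<le> cost x u"
  using weight_nonneg[of x u] by (simp add: cost_def inner_vector_matrix)

lemma R_sym: "sym_mat R" using R_pd by (simp add: pd_def)

lemma Rc_form: "u \<bullet> (Rc R r B0 Y *v w) = u \<bullet> (R *v w) + (\<Sum>i\<in>{1..r}. (B0 i *v u) \<bullet> (Y *v (B0 i *v w)))"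
  by (simp add: Rc_def Pi22_def matrix_expand sum_matrix_vector_mult inner_add_right inner_sum_right inner_vector_matrix inner_commute)

lemma Rc_sym: "sym_mat Y \<Longrightarrow> sym_mat (Rc R r B0 Y)"
  by (intro sym_matI, unfold Rc_form, intro arg_cong2[of _ _ _ _ "(+)"] sum.cong sym_mat_swap R_sym refl)

lemma Rc_ge: "psd Y \<Longrightarrow> u \<bullet> (R *v u) \<le> u \<bullet> (Rc R r B0 Y *v u)"
  unfolding Rc_form by (simp add: sum_nonneg psd_def)

lemma Rc_pd: 
  assumes "psd Y" shows "pd (Rc R r B0 Y)"
  using R_pd Rc_ge[OF assms] Rc_sym assms unfolding pd_def psd_def
  by (meson order_less_le_trans)

lemma Rc_inv: "psd Y \<Longrightarrow> Rc R r B0 Y *v (matrix_inv (Rc R r B0 Y) *v w) = w"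
  by (simp add: matrix_vector_mul_assoc pd_matrix_inv Rc_pd)

lemma Rc_inv_sym: 
  assumes "psd Y" shows "sym_mat (matrix_inv (Rc R r B0 Y))" (is "sym_mat ?I")
proof (rule sym_matI)
  fix u z
  have "(?I *v u) \<bullet> (Rc R r B0 Y *v (?I *v z)) = (Rc R r B0 Y *v (?I *v u)) \<bullet> (?I *v z)"
    using sym_mat_inner[OF Rc_sym] assms by (simp add: psd_def)
  then show "u \<bullet> (?I *v z) = z \<bullet> (?I *v u)" by (simp add: Rc_inv assms inner_commute)
qed

lemma Lc_form: "x v* Lc L r A0 B0 Y = x v* L + (\<Sum>i\<in>{1..r}. ((A0 i *v x) v* Y) v* B0 i)"
  by (simp add: Lc_def Pi12_def vector_matrix_mult_add_rdistrib vector_matrix_mult_sum vector_matrix_mul_assoc[symmetric])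

lemma Qc_form: "x \<bullet> (Qc Q r A0 Y *v z) = x \<bullet> (Q *v z) + (\<Sum>i\<in>{1..r}. (A0 i *v x) \<bullet> (Y *v (A0 i *v z)))"
  by (simp add: Qc_def Pi11_def matrix_expand sum_matrix_vector_mult inner_add_right inner_sum_right inner_vector_matrix inner_commute)

lemma gain_apply: "gain Y X *v x = - (matrix_inv (Rc R r B0 Y) *v ((X *v x) v* B + x v* Lc L r A0 B0 Y))"
  by (simp add: gain_def matrix_expand)

lemma closed_loop: "Ac A B L R r A0 B0 Y - Gc B R r B0 Y ** X = A + B ** gain Y X"
  unfolding matrix_eq
  by (simp add: gain_apply Ac_def Gc_def matrix_expand matrix_vector_mult_diff_distrib linear_neg[OF matrix_vector_mul_linear])

lemma Qc_sym: "sym_mat Y \<Longrightarrow> sym_mat (Qc Q r A0 Y)"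
  by (intro sym_matI, unfold Qc_form, intro arg_cong2[of _ _ _ _ "(+)"] sum.cong sym_mat_swap Q_sym refl)

text \<open>The polarized form exposes every occurrence of the inverse; symmetry of
  \<open>care Y X\<close> and its quadratic form are both read off from it.\<close>

lemma care_bilinear:
  fixes Y X
  defines "I \<equiv> matrix_inv (Rc R r B0 Y)" and "b \<equiv> \<lambda>x. (X *v x) v* B" and "l \<equiv> \<lambda>x. x v* Lc L r A0 B0 Y"
  assumes X: "sym_mat X"
  shows "z \<bullet> (care Y X *v x) = (X *v x) \<bullet> (A *v z) + (X *v z) \<bullet> (A *v x) + z \<bullet> (Qc Q r A0 Y *v x)
     - (b x \<bullet> (I *v l z) + b z \<bullet> (I *v l x) + b z \<bullet> (I *v b x) + l z \<bullet> (I *v l x))"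
proof -
  have X': "v \<bullet> (X *v y) = (X *v v) \<bullet> y" for v y by (simp add: sym_mat_inner X)
  have B: "v \<bullet> (B *v u) = (v v* B) \<bullet> u" for v u by (simp add: dot_lmul_matrix)
  have L: "v \<bullet> (Lc L r A0 B0 Y *v u) = (v v* Lc L r A0 B0 Y) \<bullet> u" for v u
    by (simp add: dot_lmul_matrix)
  have "z \<bullet> (care Y X *v x) = (X *v x) \<bullet> (Ac A B L R r A0 B0 Y *v z) + z \<bullet> (X *v (Ac A B L R r A0 B0 Y *v x))
      - z \<bullet> (X *v (Gc B R r B0 Y *v (X *v x))) + z \<bullet> (Hc Q L R r A0 B0 Y *v x)"
    by (simp add: care_def matrix_expand inner_vector_matrix inner_add_right inner_diff_right)
  also have "\<dots> = (X *v x) \<bullet> (Ac A B L R r A0 B0 Y *v z) + (X *v z) \<bullet> (Ac A B L R r A0 B0 Y *v x)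
      - (X *v z) \<bullet> (Gc B R r B0 Y *v (X *v x)) + z \<bullet> (Hc Q L R r A0 B0 Y *v x)"
    by (simp only: X')
  also have "\<dots> = (X *v x) \<bullet> (A *v z) + (X *v z) \<bullet> (A *v x) + z \<bullet> (Qc Q r A0 Y *v x)
     - (b x \<bullet> (I *v l z) + b z \<bullet> (I *v l x) + b z \<bullet> (I *v b x) + l z \<bullet> (I *v l x))"
    by (simp add: Ac_def Gc_def Hc_def matrix_expand inner_diff_right B L b_def l_def I_def)
  finally show ?thesis .
qed

lemma care_sym:
  assumes "psd Y" "sym_mat X"
  shows "sym_mat (care Y X)"
proof (rule sym_matI)
  fix u z
  note I = sym_mat_swap[OF Rc_inv_sym[OF assms(1)]]
  have Y: "sym_mat Y" using assms(1) by (simp add: psd_def)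
  show "u \<bullet> (care Y X *v z) = z \<bullet> (care Y X *v u)"
    unfolding care_bilinear[OF assms(2)]
    using I[of "(X *v u) v* B" "(X *v z) v* B"] I[of "u v* Lc L r A0 B0 Y" "z v* Lc L r A0 B0 Y"]
      sym_mat_swap[OF Qc_sym[OF Y], of u z]
    by simp
qed

lemma care_form:
  fixes Y X x
  defines "w \<equiv> (X *v x) v* B + x v* Lc L r A0 B0 Y"
  assumes "psd Y" "sym_mat X"
  shows "x \<bullet> (care Y X *v x) = 2 * ((X *v x) \<bullet> (A *v x)) + x \<bullet> (Qc Q r A0 Y *v x)
     - w \<bullet> (matrix_inv (Rc R r B0 Y) *v w)"
  using sym_mat_swap[OF Rc_inv_sym[OF assms(2)], of "x v* Lc L r A0 B0 Y" "(X *v x) v* B"]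
  by (simp add: care_bilinear[OF assms(3)] w_def matrix_vector_right_distrib inner_add_left inner_add_right)

text \<open>In \<open>u\<close> the Hamiltonian is a quadratic with matrix \<open>Rc\<close> and
  linear part \<open>2 (w \<bullet> u)\<close>, so its minimiser is \<open>- Rc^-1 w\<close>, the
  optimal feedback.\<close>

lemma ham_complete_square:
  assumes Y: "psd Y" and X: "sym_mat X"
  shows "ham Y X x u = x \<bullet> (care Y X *v x)
    + (u - gain Y X *v x) \<bullet> (Rc R r B0 Y *v (u - gain Y X *v x))"
proof -
  let ?I = "matrix_inv (Rc R r B0 Y)"
  define w where "w = (X *v x) v* B + x v* Lc L r A0 B0 Y"
  have Ys: "sym_mat Y" using Y by (simp add: psd_def)
  have "w \<bullet> u = (X *v x) \<bullet> (B *v u) + x \<bullet> (L *v u) + (\<Sum>i\<in>{1..r}. (A0 i *v x) \<bullet> (Y *v (B0 i *v u)))"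
    by (simp add: w_def Lc_form inner_simps inner_sum_left dot_lmul_matrix)
  moreover have "noise Y x u = (\<Sum>i\<in>{1..r}. (A0 i *v x) \<bullet> (Y *v (A0 i *v x)))
      + 2 * (\<Sum>i\<in>{1..r}. (A0 i *v x) \<bullet> (Y *v (B0 i *v u))) + (\<Sum>i\<in>{1..r}. (B0 i *v u) \<bullet> (Y *v (B0 i *v u)))"
    unfolding noise_def sum.distrib[symmetric] sum_distrib_left
  proof (rule sum.cong)
    fix i
    show "(A0 i *v x + B0 i *v u) \<bullet> (Y *v (A0 i *v x + B0 i *v u)) = 
      (A0 i *v x) \<bullet> (Y *v (A0 i *v x)) + 2 * ((A0 i *v x) \<bullet> (Y *v (B0 i *v u))) + (B0 i *v u) \<bullet> (Y *v (B0 i *v u))"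
      using sym_mat_swap[OF Ys, of "A0 i *v x" "B0 i *v u"]
      by (simp add: matrix_vector_right_distrib inner_add_left inner_add_right)
  qed simp
  ultimately have h: "ham Y X x u = 2 * ((X *v x) \<bullet> (A *v x)) + x \<bullet> (Qc Q r A0 Y *v x) + 2 * (w \<bullet> u) + u \<bullet> (Rc R r B0 Y *v u)"
    by (simp add: ham_def cost_def Rc_form Qc_form inner_simps algebra_simps)
  have g: "u - gain Y X *v x = u + ?I *v w" by (simp add: gain_apply w_def)
  have "(?I *v w) \<bullet> (Rc R r B0 Y *v u) = w \<bullet> u"
    using sym_mat_inner[OF Rc_sym[OF Ys], of "?I *v w" u] by (simp add: Rc_inv[OF Y])
  then show ?thesis
    unfolding h g care_form[OF Y X] w_def[symmetric]
    by (simp add: matrix_vector_right_distrib Rc_inv[OF Y] inner_add_left inner_add_right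
        inner_commute[of "matrix_inv (Rc R r B0 Y) *v w" w] inner_commute[of u w])
qed

lemma ham_ge: "psd Y \<Longrightarrow> sym_mat X \<Longrightarrow> x \<bullet> (care Y X *v x) \<le> ham Y X x u"
  using Rc_pd[of Y] unfolding ham_complete_square pd_def
  by (metis add.right_neutral add_left_mono inner_zero_left less_eq_real_def)

lemma ham_gain: "psd Y \<Longrightarrow> sym_mat X \<Longrightarrow> ham Y X x (gain Y X *v x) = x \<bullet> (care Y X *v x)"
  by (simp add: ham_complete_square)

text \<open>Expresses the deviation from the optimal input through the gradient, which passes to the
  limit without continuity of matrix inversion.\<close>

lemma Rc_grad:
  assumes "psd Y"
  shows "Rc R r B0 Y *v (u - gain Y X *v x) = grad Y X x u"
proof -
  have Ys: "sym_mat Y" using assms by (simp add: psd_def)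
  define w where "w = (X *v x) v* B + x v* Lc L r A0 B0 Y"
  have "u - gain Y X *v x = u + matrix_inv (Rc R r B0 Y) *v w"
    by (simp add: gain_apply w_def)
  then have "Rc R r B0 Y *v (u - gain Y X *v x) = Rc R r B0 Y *v u + w"
    by (simp only: matrix_vector_right_distrib Rc_inv[OF assms])
  also have "\<dots> = grad Y X x u"
    by (simp add: w_def grad_def Lc_form sym_mat_vector_matrix[OF Ys] matrix_expand
        vector_matrix_left_distrib sum.distrib Rc_def Pi22_def sum_matrix_vector_mult)
  finally show ?thesis .
qed

text \<open>The Schur complement \<open>Q - L R^-1 L^T\<close> equals \<open>care 0 0\<close>, hence
  is the minimum of the cost over inputs. Zero cost puts \<open>x\<close> in its kernel; the kernel
  condition then removes the cross term, and definiteness of \<open>R\<close> removes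
  \<open>u\<close>.\<close>

lemma cost_eq_0:
  assumes "cost x u = 0"
  shows "(Q - L ** matrix_inv R ** transpose L) *v x = 0" "u = 0" "\<forall>i\<in>{1..r}. A0 i *v x = 0"
proof -
  let ?H = "Q - L ** matrix_inv R ** transpose L"
  have [simp]: "M ** (0::real^'n^'n) = 0" "0 ** N = 0" for M :: "real^'n^'k" and N :: "real^'k^'n"
    by (simp_all add: matrix_matrix_mult_def vec_eq_iff)
  have Rc0: "Rc R r B0 0 = R" and Lc0: "Lc L r A0 B0 0 = L"
    by (simp_all add: Rc_def Pi22_def Lc_def Pi12_def)
  have care0: "care 0 0 = ?H"
    by (simp add: care_def Hc_def Qc_def Pi11_def Rc0 Lc0)
  have c: "cost x u = ham 0 0 x u" for x u by (simp add: ham_def noise_def)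
  have sym0: "sym_mat (0::real^'n^'n)" using psd_0 by (simp add: psd_def)
  have "0 \<le> x \<bullet> (?H *v x)" for x
    using cost_nonneg[of x "gain 0 0 *v x"] ham_gain[OF psd_0 sym0, of x] unfolding c care0 by simp
  then have H: "psd ?H"
    using care_sym[OF psd_0 sym0] by (simp add: psd_def care0)
  have "x \<bullet> (?H *v x) = 0"
    using ham_ge[OF psd_0 sym0, of x u] assms H unfolding c care0 psd_def by (simp add: antisym)
  then show H0: "?H *v x = 0" using psd_ker[OF H] by blast
  from kernel[OF H0] show "\<forall>i\<in>{1..r}. A0 i *v x = 0" by blast
  have "x v* L = 0" using kernel[OF H0] by simp
  then have "x \<bullet> (L *v u) = 0" by (metis dot_lmul_matrix inner_zero_left)
  moreover have "0 \<le> x \<bullet> (Q *v x)" using cost_nonneg[of x 0] by (simp add: cost_def)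
  ultimately have "u \<bullet> (R *v u) \<le> 0" using assms by (simp add: cost_def)
  then show "u = 0" using R_pd unfolding pd_def by (meson not_less)
qed

section \<open>Stability of closed loops and domination of the noise\<close>

lemma closed_loop_hurwitz:
  assumes Y: "psd Y" and X: "psd X" and le: "\<And>x. ham Y X x (F *v x) \<le> 0"
  shows "hurwitz (A + B ** F)"
  unfolding hurwitz_iff_real
proof (intro allI impI)
  fix s w a b
  assume ab: "a \<noteq> 0 \<or> b \<noteq> 0"
    and a: "(A + B ** F) *v a = s *\<^sub>R a - w *\<^sub>R b"
    and b: "(A + B ** F) *v b = w *\<^sub>R a + s *\<^sub>R b"
  \<comment> \<open>Popov-Belevitch-Hautus test: an eigenvector with \<open>s \<ge> 0\<close> has zero cost, so it is unobservable
    and the feedback does not act on it.\<close>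
  show "s < 0"
  proof (rule ccontr)
    assume "\<not> s < 0"
    then have s: "s \<ge> 0" by simp
    have a': "A *v a + B *v (F *v a) = s *\<^sub>R a - w *\<^sub>R b"
      and b': "A *v b + B *v (F *v b) = w *\<^sub>R a + s *\<^sub>R b"
      using a b by (simp_all add: matrix_expand)
    have Xs: "sym_mat X" and Xn: "0 \<le> a \<bullet> (X *v a)" "0 \<le> b \<bullet> (X *v b)"
      using X by (auto simp: psd_def)
    \<comment> \<open>Adding the real and imaginary parts cancels the \<open>w\<close> terms by
      symmetry of \<open>X\<close>; what remains is nonnegative, so both costs must vanish.\<close>
    have "(X *v a) \<bullet> (s *\<^sub>R a - w *\<^sub>R b) + (X *v b) \<bullet> (w *\<^sub>R a + s *\<^sub>R b)
        = s * (a \<bullet> (X *v a) + b \<bullet> (X *v b))"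
      using sym_mat_inner[OF Xs, of a b] by (simp add: inner_simps inner_commute algebra_simps)
    moreover have "\<dots> \<ge> 0" using s Xn by simp
    ultimately have "cost a (F *v a) = 0 \<and> cost b (F *v b) = 0"
      using le[of a] le[of b] cost_nonneg[of a "F *v a"] cost_nonneg[of b "F *v b"]
        noise_nonneg[OF Y, of a "F *v a"] noise_nonneg[OF Y, of b "F *v b"]
      unfolding ham_def a' b' by linarith
    then have z: "(Q - L ** matrix_inv R ** transpose L) *v a = 0" "(Q - L ** matrix_inv R ** transpose L) *v b = 0"
        "F *v a = 0" "F *v b = 0"
      using cost_eq_0 by blast+
    obtain K where K: "hurwitz (A + K ** (Q - L ** matrix_inv R ** transpose L))" using detectable by blast
    have "(A + K ** (Q - L ** matrix_inv R ** transpose L)) *v a = s *\<^sub>R a - w *\<^sub>R b"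
      "(A + K ** (Q - L ** matrix_inv R ** transpose L)) *v b = w *\<^sub>R a + s *\<^sub>R b"
      using a' b' z by (simp_all add: matrix_vector_mult_add_rdistrib matrix_vector_mul_assoc[symmetric])
    then have "s < 0" using K[unfolded hurwitz_iff_real, rule_format, OF ab] by blast
    with s show False by simp
  qed
qed

text \<open>Along a linear feedback both sides are quadratic forms in \<open>x\<close>. Zero cost
  forces zero input and \<open>A0 i x = 0\<close>, hence no noise, so \<open>psd_domination\<close>
  applies.\<close>

lemma noise_domination:
  assumes Y: "psd Y"
  shows "\<exists>c\<ge>0. \<forall>x. noise Y x (F *v x) \<le> c * cost x (F *v x)"
proof -
  define W where "W = Q + L ** F + transpose F ** transpose L + transpose F ** R ** F"
  define V where "V = (\<Sum>i\<in>{1..r}. transpose (A0 i + B0 i ** F) ** Y ** (A0 i + B0 i ** F))"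
  have Ys: "sym_mat Y" using Y by (simp add: psd_def)
  have W: "x \<bullet> (W *v x) = cost x (F *v x)" for x
    by (simp add: W_def cost_def matrix_expand inner_add_right inner_vector_matrix dot_lmul_matrix
        inner_commute[of "R *v _"])
  have V: "z \<bullet> (V *v x) = (\<Sum>i\<in>{1..r}. (A0 i *v z + B0 i *v (F *v z)) \<bullet> (Y *v (A0 i *v x + B0 i *v (F *v x))))" for x z
    unfolding V_def sum_matrix_vector_mult inner_sum_right
    by (simp add: matrix_vector_mul_assoc[symmetric] inner_vector_matrix inner_commute[of "Y *v _"])
       (simp add: matrix_expand inner_commute[of "Y *v _"])
  have "sym_mat W"
  proof (rule sym_matI)
    fix u z
    have "u \<bullet> (W *v z) = u \<bullet> (Q *v z) + u \<bullet> (L *v (F *v z)) + z \<bullet> (L *v (F *v u)) + (F *v u) \<bullet> (R *v (F *v z))" for u z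
      by (simp add: W_def matrix_expand inner_add_right inner_vector_matrix dot_lmul_matrix
          inner_commute[of "R *v _"])
    then show "u \<bullet> (W *v z) = z \<bullet> (W *v u)"
      using sym_mat_swap[OF Q_sym, of u z] sym_mat_swap[OF R_sym, of "F *v u" "F *v z"] by simp
  qed
  then have "psd W" by (simp add: psd_def W cost_nonneg)
  moreover have "sym_mat V"
    by (rule sym_matI, unfold V, intro sum.cong sym_mat_swap Ys refl)
  moreover have "V *v x = 0" if "W *v x = 0" for x
  proof -
    have "cost x (F *v x) = 0" using that W[of x] by simp
    from cost_eq_0[OF this] have "z \<bullet> (V *v x) = 0" for z
      unfolding V by (intro sum.neutral) simp
    then show ?thesis by (metis inner_eq_zero_iff)
  qed
  ultimately obtain c where "c \<ge> 0" "\<forall>x. x \<bullet> (V *v x) \<le> c * (x \<bullet> (W *v x))"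
    using psd_domination by blast
  then show ?thesis by (auto simp: V W noise_def)
qed

text \<open>Because the noise is dominated by the cost, a bound \<open>D \<le> s X\<close> can be improved to \<open>D \<le> q s X\<close>
  with \<open>q < 1\<close> independent of \<open>s\<close>; iterating gives \<open>D \<le> 0\<close>.\<close>
lemma closed_loop_subsolution_nonpos:
  assumes X: "psd X" and D: "psd D" and F: "\<And>x. ham X X x (F *v x) \<le> 0"
    and ge: "\<And>x. 0 \<le> 2 * ((D *v x) \<bullet> (A *v x + B *v (F *v x))) + noise D x (F *v x)"
  shows "x \<bullet> (D *v x) \<le> 0"
proof -
  define N where "N = A + B ** F"
  have N: "A *v x + B *v (F *v x) = N *v x" for x by (simp add: N_def matrix_expand)
  have hN: "hurwitz N" unfolding N_def using closed_loop_hurwitz[OF X X F] .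
  obtain c1 where c1: "c1 \<ge> 0" "\<And>x. noise D x (F *v x) \<le> c1 * cost x (F *v x)"
    using noise_domination[OF D] by blast
  obtain c2 where c2: "c2 \<ge> 0" "\<And>x. noise X x (F *v x) \<le> c2 * cost x (F *v x)"
    using noise_domination[OF X] by blast
  have Xle: "2 * ((X *v x) \<bullet> (N *v x)) \<le> - cost x (F *v x) - noise X x (F *v x)" for x
    using F[of x] unfolding ham_def N by linarith
  have Dge: "- noise D x (F *v x) \<le> 2 * ((D *v x) \<bullet> (N *v x))" for x
    using ge[of x] unfolding N by linarith
  \<comment> \<open>If \<open>s\<close> times the dissipation of \<open>X\<close> dominates the
    noise of \<open>D\<close>, then \<open>s X - D\<close> satisfies a Lyapunov inequality along the
    Hurwitz matrix \<open>N\<close>.\<close>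
  have lyap: "y \<bullet> (D *v y) \<le> s * (y \<bullet> (X *v y))"
    if "s \<ge> 0" and le: "\<And>x. noise D x (F *v x) \<le> s * (cost x (F *v x) + noise X x (F *v x))" for s y
  proof -
    have "0 \<le> y \<bullet> ((s *\<^sub>R X - D) *v y)"
    proof (rule lyapunov_nonneg[OF hN])
      show "sym_mat (s *\<^sub>R X - D)"
        using X D unfolding psd_def by (intro sym_mat_diff sym_mat_scaleR) auto
      fix x
      have "s * (2 * ((X *v x) \<bullet> (N *v x))) \<le> s * (- cost x (F *v x) - noise X x (F *v x))"
        by (rule mult_left_mono[OF Xle that(1)])
      with le[of x] Dge[of x] have "2 * (s * ((X *v x) \<bullet> (N *v x)) - (D *v x) \<bullet> (N *v x)) \<le> 0"
        by (simp add: algebra_simps)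
      then show "((s *\<^sub>R X - D) *v x) \<bullet> (N *v x) \<le> 0"
        by (simp add: matrix_vector_mult_diff_rdistrib scaleR_matrix_vector_assoc[symmetric] inner_diff_left)
    qed
    then show ?thesis
      by (simp add: matrix_vector_mult_diff_rdistrib scaleR_matrix_vector_assoc[symmetric] inner_diff_right)
  qed
  \<comment> \<open>From \<open>noise <= c2 * cost\<close> it follows that
    \<open>noise <= q * (cost + noise)\<close>; this is the contraction factor.\<close>
  define q where "q = c2 / (1 + c2)"
  have q: "0 \<le> q" "q < 1" using c2(1) by (auto simp: q_def)
  have "y \<bullet> (D *v y) \<le> (q ^ k * c1) * (y \<bullet> (X *v y))" for k y
  proof (induction k arbitrary: y)
    case 0
    have "noise D x (F *v x) \<le> c1 * (cost x (F *v x) + noise X x (F *v x))" for x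
      using c1 noise_nonneg[OF X, of x "F *v x"] by (smt (verit) mult_left_mono)
    from lyap[OF c1(1) this] show ?case by simp
  next
    case (Suc k)
    let ?s = "q ^ k * c1"
    have s: "?s \<ge> 0" using q c1 by simp
    have "q * ?s \<ge> 0" using s q by simp
    moreover have "noise D x (F *v x) \<le> (q * ?s) * (cost x (F *v x) + noise X x (F *v x))" for x
    proof -
      \<comment> \<open>The induction hypothesis is applied to the noise vectors
        \<open>A0 i x + B0 i (F x)\<close> themselves.\<close>
      have "noise D x (F *v x) \<le> ?s * noise X x (F *v x)"
        unfolding noise_def sum_distrib_left by (intro sum_mono Suc)
      also have "\<dots> \<le> ?s * (q * (cost x (F *v x) + noise X x (F *v x)))"
      proof (rule mult_left_mono[OF _ s])
        have "(1 + c2) * noise X x (F *v x) \<le> c2 * (cost x (F *v x) + noise X x (F *v x))"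
          using c2(2)[of x] by (simp add: algebra_simps)
        then show "noise X x (F *v x) \<le> q * (cost x (F *v x) + noise X x (F *v x))"
          using c2(1) by (simp add: q_def field_simps)
      qed
      finally show ?thesis by (simp add: mult_ac)
    qed
    ultimately have "y \<bullet> (D *v y) \<le> (q * ?s) * (y \<bullet> (X *v y))" by (rule lyap)
    then show ?case by (simp add: mult_ac)
  qed
  moreover have "(\<lambda>k. (q ^ k * c1) * (x \<bullet> (X *v x))) \<longlonglongrightarrow> 0"
    using LIMSEQ_realpow_zero[OF q] by (intro tendsto_mult_left_zero)
  ultimately show ?thesis
    by (meson LIMSEQ_le_const)
qed

lemma tendsto_noise:
  "X \<longlonglongrightarrow> Z \<Longrightarrow> (\<lambda>k. noise (X k) x u) \<longlonglongrightarrow> noise Z x u"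
  unfolding noise_def by (intro tendsto_intros tendsto_matrix_vector_mult)

lemma tendsto_ham:
  "Y \<longlonglongrightarrow> Z \<Longrightarrow> X \<longlonglongrightarrow> Z' \<Longrightarrow> (\<lambda>k. ham (Y k) (X k) x u) \<longlonglongrightarrow> ham Z Z' x u"
  unfolding ham_def by (intro tendsto_intros tendsto_matrix_vector_mult tendsto_noise)

lemma tendsto_grad:
  "Y \<longlonglongrightarrow> Z \<Longrightarrow> X \<longlonglongrightarrow> Z' \<Longrightarrow> (\<lambda>k. grad (Y k) (X k) x u) \<longlonglongrightarrow> grad Z Z' x u"
  unfolding grad_def by (intro tendsto_intros tendsto_matrix_vector_mult tendsto_vector_matrix_mult)

text \<open>The optimal input for \<open>Z\<close> is asymptotically stationary for the iterates. As
  \<open>care (X k) (X (Suc k))\<close> vanishes, the Hamiltonian there is only the square term, at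
  most a constant times the squared gradient.\<close>

lemma ham_limit_le:
  assumes psd: "\<And>k. psd (X k)" and Z: "psd Z" and lim: "X \<longlonglongrightarrow> Z"
    and care0: "\<And>k. care (X k) (X (Suc k)) = 0"
  shows "ham Z Z x (gain Z Z *v x) \<le> 0"
proof -
  have "psd R" using R_pd unfolding pd_def psd_def by (metis inner_zero_left less_eq_real_def)
  moreover have "sym_mat (mat 1 :: real^'m^'m)" by (simp add: sym_mat_def)
  moreover have "mat 1 *v u = 0" if "R *v u = 0" for u
    using R_pd that unfolding pd_def by (metis inner_zero_right less_irrefl matrix_vector_mul_lid)
  \<comment> \<open>Coercivity of \<open>R\<close> gives one constant for all \<open>k\<close>,
    because \<open>Rc\<close> at a semidefinite matrix dominates \<open>R\<close>.\<close>
  ultimately obtain c where c: "c \<ge> 0" "\<And>u. u \<bullet> u \<le> c * (u \<bullet> (R *v u))"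
    using psd_domination[of R "mat 1"] by auto
  define u where "u = gain Z Z *v x"
  define g where "g k = grad (X k) (X (Suc k)) x u" for k
  have "g \<longlonglongrightarrow> grad Z Z x u"
    unfolding g_def by (rule tendsto_grad[OF lim LIMSEQ_Suc[OF lim]])
  moreover have "grad Z Z x u = 0"
    unfolding Rc_grad[OF Z, symmetric] by (simp add: u_def)
  ultimately have g: "g \<longlonglongrightarrow> 0" by simp
  have le: "ham (X k) (X (Suc k)) x u \<le> c * (norm (g k))\<^sup>2" for k
  proof -
    define y where "y = u - gain (X k) (X (Suc k)) *v x"
    have sym: "sym_mat (X (Suc k))" using psd by (simp add: psd_def)
    have yR: "Rc R r B0 (X k) *v y = g k" unfolding y_def g_def by (rule Rc_grad[OF psd])
    have h: "ham (X k) (X (Suc k)) x u = y \<bullet> g k"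
      unfolding ham_complete_square[OF psd sym] care0 y_def[symmetric] yR by simp
    have "y \<bullet> y \<le> c * (y \<bullet> g k)"
      using c Rc_ge[OF psd, of y k] unfolding yR by (meson mult_left_mono order_trans)
    also have "\<dots> \<le> c * (norm y * norm (g k))"
      by (intro mult_left_mono norm_cauchy_schwarz c)
    finally have "norm y * norm y \<le> norm y * (c * norm (g k))"
      by (simp add: power2_norm_eq_inner[symmetric] power2_eq_square mult_ac)
    then have "norm y \<le> c * norm (g k)"
      by (cases "y = 0") (use c in auto)
    then have "norm y * norm (g k) \<le> c * norm (g k) * norm (g k)"
      by (rule mult_right_mono) simp
    then show ?thesis
      using norm_cauchy_schwarz[of y "g k"] unfolding h by (simp add: power2_eq_square)
  qed
  have "(\<lambda>k. c * (norm (g k))\<^sup>2) \<longlonglongrightarrow> c * (norm (0::real^'m))\<^sup>2"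
    by (intro tendsto_intros g)
  moreover have "(\<lambda>k. ham (X k) (X (Suc k)) x u) \<longlonglongrightarrow> ham Z Z x u"
    by (rule tendsto_ham[OF lim LIMSEQ_Suc[OF lim]])
  ultimately have "ham Z Z x u \<le> c * (norm (0::real^'m))\<^sup>2"
    using le by (intro LIMSEQ_le) auto
  then show ?thesis by (simp add: u_def)
qed

end

section \<open>Monotone convergence of the fixed-point iteration\<close>

theorem theorem3p2:
  fixes A :: "real^'n^'n" and B :: "real^'m^'n" and Q :: "real^'n^'n"
    and L :: "real^'m^'n" and R :: "real^'m^'m" and r :: nat
    and A0 :: "nat \<Rightarrow> real^'n^'n" and B0 :: "nat \<Rightarrow> real^'m^'n"
    and Xs :: "real^'n^'n" and X :: "nat \<Rightarrow> real^'n^'n"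
  assumes std: "standing_assumptions A B Q L R r A0 B0"
    and Xs_psd: "psd Xs"
    and Xs_sol: "sriccati A B Q L R r A0 B0 Xs = 0"
    and X0: "X 0 = 0"
    and Xstep: "\<And>k. care_stabilizing_sol (Ac A B L R r A0 B0 (X k)) (Gc B R r B0 (X k))
                      (Hc Q L R r A0 B0 (X k)) (X (Suc k))"
  shows "(\<forall>k. loewner_le (X k) (X (Suc k)) \<and> loewner_le (X k) Xs
              \<and> psd (sriccati A B Q L R r A0 B0 (X k))
              \<and> hurwitz (Ac A B L R r A0 B0 (X k) - Gc B R r B0 (X k) ** Xs))
         \<and> loewner_le 0 Xs \<and> X \<longlonglongrightarrow> Xs
         \<and> (\<forall>mu\<in>eigvals (Ac A B L R r A0 B0 Xs - Gc B R r B0 Xs ** Xs). Re mu \<le> 0)"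
proof -
  interpret riccati_system A B Q L R r A0 B0
    using std unfolding standing_assumptions_def Let_def by unfold_locales blast+
  have sric: "sriccati A B Q L R r A0 B0 Y = care Y Y" for Y
    by (simp add: sriccati_def care_def)
  have Xs_sym: "sym_mat Xs" using Xs_psd by (simp add: psd_def)
  have X_sym: "sym_mat (X k)" for k
    by (cases k) (use X0 psd_0 Xstep in \<open>auto simp: psd_def care_stabilizing_sol_def\<close>)
  have care_step: "care (X k) (X (Suc k)) = 0" for k
    using Xstep[of k] by (simp add: care_stabilizing_sol_def care_def)
  define F where "F k = gain (X k) (X (Suc k))" for k
  have hurw: "hurwitz (A + B ** F k)" for k
    using Xstep[of k] by (simp add: care_stabilizing_sol_def closed_loop F_def)
  have Xs_ham: "0 \<le> ham Xs Xs x u" for x u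
    using ham_ge[OF Xs_psd Xs_sym, of x u] Xs_sol by (simp add: sric)
  define Fs where "Fs = gain Xs Xs"
  have Fs_ham: "ham Xs Xs x (Fs *v x) = 0" for x
    using ham_gain[OF Xs_psd Xs_sym, of x] Xs_sol by (simp add: sric Fs_def)
  have hurw_s: "hurwitz (A + B ** Fs)"
    by (rule closed_loop_hurwitz[OF Xs_psd Xs_psd]) (simp add: Fs_ham)
  \<comment> \<open>Comparison principle: the Lyapunov inequality for \<open>Z - Y\<close> along a
    stable feedback \<open>G\<close> orders \<open>Y\<close> below \<open>Z\<close>.\<close>
  have lyap: "loewner_le Y Z"
    if "hurwitz (A + B ** G)" "sym_mat Y" "sym_mat Z"
      and le: "\<And>x. (Z *v x) \<bullet> (A *v x + B *v (G *v x)) \<le> (Y *v x) \<bullet> (A *v x + B *v (G *v x))"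
    for G Y Z
  proof -
    have sym: "sym_mat (Z - Y)" by (rule sym_mat_diff[OF that(3,2)])
    have "((Z - Y) *v x) \<bullet> ((A + B ** G) *v x) \<le> 0" for x
      using le[of x] by (simp add: matrix_vector_mult_diff_rdistrib inner_diff_left
          matrix_vector_mult_add_rdistrib matrix_vector_mul_assoc[symmetric])
    from lyapunov_nonneg[OF that(1) sym this] show ?thesis
      using sym by (simp add: loewner_le_def psd_def)
  qed
  \<comment> \<open>The condition \<open>0 <= ham (X k) (X k) x u\<close> for all inputs expresses
    semidefiniteness of the residual; being free of the optimal gain, it can be compared between
    iterates.\<close>
  have main: "psd (X k) \<and> loewner_le (X k) Xs \<and> (\<forall>x u. 0 \<le> ham (X k) (X k) x u)
      \<and> loewner_le (X k) (X (Suc k))" for k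
  proof (induction k)
    case 0
    have "0 \<le> ham 0 0 x u" for x u
      using cost_nonneg[of x u] by (simp add: ham_def noise_def)
    moreover have "loewner_le 0 (X (Suc 0))"
    proof (rule lyap[OF hurw[of 0]])
      fix x
      have "ham 0 (X (Suc 0)) x (F 0 *v x) = 0"
        using ham_gain[OF psd_0 X_sym, of "Suc 0" x] care_step[of 0] X0 by (simp add: F_def)
      then show "(X (Suc 0) *v x) \<bullet> (A *v x + B *v (F 0 *v x)) \<le> (0 *v x) \<bullet> (A *v x + B *v (F 0 *v x))"
        using cost_nonneg[of x "F 0 *v x"] by (simp add: ham_def noise_def)
    qed (use psd_0 X_sym in \<open>auto simp: psd_def\<close>)
    ultimately show ?case using psd_0 Xs_psd by (simp add: X0 loewner_le_def)
  next
    case (Suc k)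
    then have Xk: "psd (X k)" "psd (Xs - X k)" "psd (X (Suc k) - X k)" by (auto simp: loewner_le_def)
    have "0 \<le> x \<bullet> (X (Suc k) *v x)" for x
      using Xk unfolding psd_def
      by (smt (verit) inner_diff_right matrix_vector_mult_diff_rdistrib)
    then have psd: "psd (X (Suc k))" using X_sym by (simp add: psd_def)
    have step_ge: "0 \<le> ham (X k) (X (Suc k)) x u" for x u
      using ham_ge[OF Xk(1) X_sym, of x "Suc k" u] by (simp add: care_step)
    have ham: "0 \<le> ham (X (Suc k)) (X (Suc k)) x u" for x u
      using step_ge[of x u] noise_nonneg[OF Xk(3), of x u] unfolding ham_def noise_diff by linarith
    have "loewner_le (X (Suc k)) Xs"
    proof (rule lyap[OF hurw_s X_sym Xs_sym])
      fix x
      \<comment> \<open>At the feedback of \<open>Xs\<close> the Hamiltonian of \<open>Xs\<close>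
        vanishes and that of the iterate is nonnegative, while the noise of \<open>Xs\<close> is the
        larger one.\<close>
      show "(Xs *v x) \<bullet> (A *v x + B *v (Fs *v x)) \<le> (X (Suc k) *v x) \<bullet> (A *v x + B *v (Fs *v x))"
        using step_ge[of x "Fs *v x"] Fs_ham[of x] noise_nonneg[OF Xk(2), of x "Fs *v x"]
        unfolding ham_def noise_diff by linarith
    qed
    moreover have "loewner_le (X (Suc k)) (X (Suc (Suc k)))"
    proof (rule lyap[OF hurw[of "Suc k"] X_sym X_sym])
      fix x
      have "ham (X (Suc k)) (X (Suc (Suc k))) x (F (Suc k) *v x) = 0"
        using ham_gain[OF psd X_sym, of "Suc (Suc k)" x] by (simp add: F_def care_step)
      then show "(X (Suc (Suc k)) *v x) \<bullet> (A *v x + B *v (F (Suc k) *v x))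
          \<le> (X (Suc k) *v x) \<bullet> (A *v x + B *v (F (Suc k) *v x))"
        using ham[of x "F (Suc k) *v x"] unfolding ham_def by linarith
    qed
    ultimately show ?case using psd ham by blast
  qed
  have X_psd: "psd (X k)" and X_le: "psd (Xs - X k)" and X_mono: "psd (X (Suc k) - X k)"
    and X_ham: "0 \<le> ham (X k) (X k) x u" for k x u
    using main[of k] by (auto simp: loewner_le_def)
  have part_psd: "psd (sriccati A B Q L R r A0 B0 (X k))" for k
    unfolding sric psd_def using care_sym[OF X_psd X_sym] X_ham ham_gain[OF X_psd X_sym]
    by metis
  have part_hurwitz: "hurwitz (Ac A B L R r A0 B0 (X k) - Gc B R r B0 (X k) ** Xs)" for k
    unfolding closed_loop
  proof (rule closed_loop_hurwitz[OF X_psd Xs_psd])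
    fix x
    \<comment> \<open>\<open>Fs\<close> is merely admissible for the equation frozen at
      \<open>X k\<close>; lowering the coefficient from \<open>Xs\<close> to \<open>X k\<close>
      lowers the Hamiltonian, which is zero for \<open>Xs\<close>.\<close>
    have "ham (X k) Xs x (gain (X k) Xs *v x) \<le> ham (X k) Xs x (Fs *v x)"
      using ham_ge[OF X_psd Xs_sym] ham_gain[OF X_psd Xs_sym] by metis
    also have "\<dots> \<le> ham Xs Xs x (Fs *v x)"
      using noise_nonneg[OF X_le, of k x "Fs *v x"] unfolding ham_def noise_diff by linarith
    finally show "ham (X k) Xs x (gain (X k) Xs *v x) \<le> 0" by (simp add: Fs_ham)
  qed
  have quad_mono: "x \<bullet> (X k *v x) \<le> x \<bullet> (X (Suc k) *v x)" and quad_le: "x \<bullet> (X k *v x) \<le> x \<bullet> (Xs *v x)" for k x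
    using X_mono[of k] X_le[of k]
    by (auto simp: psd_def matrix_vector_mult_diff_rdistrib inner_diff_right)
  obtain Z where lim: "X \<longlonglongrightarrow> Z"
    using monotone_symmetric_convergent[of X Xs, OF X_sym quad_mono quad_le] by blast
  have quad_lim: "(\<lambda>k. u \<bullet> (X k *v x)) \<longlonglongrightarrow> u \<bullet> (Z *v x)" for u x
    by (intro tendsto_intros tendsto_matrix_vector_mult lim)
  have Z_sym: "sym_mat Z"
  proof (rule sym_matI)
    fix u z
    have "(\<lambda>k. u \<bullet> (X k *v z)) = (\<lambda>k. z \<bullet> (X k *v u))"
      using sym_mat_swap[OF X_sym] by blast
    then show "u \<bullet> (Z *v z) = z \<bullet> (Z *v u)"
      using quad_lim[of u z] quad_lim[of z u] LIMSEQ_unique by metis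
  qed
  have Z_psd: "psd Z"
    unfolding psd_def
  proof (intro conjI allI Z_sym)
    show "0 \<le> x \<bullet> (Z *v x)" for x
      by (rule LIMSEQ_le_const[OF quad_lim]) (use X_psd in \<open>auto simp: psd_def\<close>)
  qed
  define D where "D = Xs - Z"
  have D_form: "x \<bullet> (D *v x) = x \<bullet> (Xs *v x) - x \<bullet> (Z *v x)" for x
    by (simp add: D_def matrix_vector_mult_diff_rdistrib inner_diff_right)
  have D_sym: "sym_mat D" unfolding D_def by (rule sym_mat_diff[OF Xs_sym Z_sym])
  have D_psd: "psd D"
    unfolding psd_def
  proof (intro conjI allI D_sym)
    fix x
    have "x \<bullet> (Z *v x) \<le> x \<bullet> (Xs *v x)"
      by (rule LIMSEQ_le_const2[OF quad_lim]) (use quad_le in auto)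
    then show "0 \<le> x \<bullet> (D *v x)" by (simp add: D_form)
  qed
  have Z_ham: "ham Z Z x (gain Z Z *v x) \<le> 0" for x
    by (rule ham_limit_le[of X, OF X_psd Z_psd lim care_step])
  \<comment> \<open>Subtracting the Hamiltonians of \<open>Xs\<close> and \<open>Z\<close> at the
    common input \<open>gain Z Z x\<close> cancels the cost and leaves the inequality required of
    \<open>D\<close>.\<close>
  have "x \<bullet> (D *v x) \<le> 0" for x
  proof (rule closed_loop_subsolution_nonpos[OF Z_psd D_psd Z_ham])
    show "0 \<le> 2 * ((D *v x) \<bullet> (A *v x + B *v (gain Z Z *v x))) + noise D x (gain Z Z *v x)" for x
      using Xs_ham[of x "gain Z Z *v x"] Z_ham[of x]
      unfolding D_def noise_diff matrix_vector_mult_diff_rdistrib inner_diff_left ham_def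
      by (simp add: algebra_simps)
  qed
  then have "x \<bullet> (D *v x) = 0" for x using D_psd by (simp add: psd_def antisym)
  then have "D *v x = 0" for x using psd_ker[OF D_psd] by blast
  then have "D = 0" by (simp add: matrix_eq)
  then have "X \<longlonglongrightarrow> Xs" using lim by (simp add: D_def)
  \<comment> \<open>The closed loop at \<open>Xs\<close> is \<open>A + B ** Fs\<close>, so the
    strict inequality from \<open>hurw_s\<close> gives the weak one.\<close>
  moreover have "Re mu \<le> 0" if "mu \<in> eigvals (Ac A B L R r A0 B0 Xs - Gc B R r B0 Xs ** Xs)" for mu
    using that hurw_s unfolding closed_loop Fs_def hurwitz_def by (simp add: less_imp_le)
  ultimately show ?thesis
    using main part_psd part_hurwitz Xs_psd by (auto simp: loewner_le_def)
qed

end
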